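(* Consider $m$ clients with data amounts $N_j$, true sharing costs $c_j$, data-eagerness levels $K_j$, and local models $\theta^t_1,\dots,\theta^t_m$ at round $t$. Fix a client $i$ and a value $\hat c_i>c_i$. Let $U_i^t$ be the one-round utility of client $i$ in round $t$ when everyone honestly reports their cost, and let $\hat U_i^t$ be its one-round utility in round $t$ when client $i$ reports $\hat c_i$ instead of $c_i$ (all other clients reporting honestly). Then for all $t$, $\hat U_i^t\le U_i^t$.
   Context: Setting. There are $m$ clients, $[m]=\{1,\dots,m\}$. Client $i$ has a data amount $N_i$ (a positive integer), a true cost $c_i\ge 0$ (real) incurred each time another client imports its model, and a data-eagerness level $K_i\ge 0$ (real). At round $t$ client $i$ has model parameters $\theta_i^t$ (a real vector, of the same dimension for all clients). $d(\cdot,\cdot)\ge 0$ is a fixed differentiable real-valued function measuring the difference between two models, and $\lambda>0$ is a fixed constant. Sharing graph. $\mathbf{A}^t=(a^t_{ij})\in\{0,1\}^{m\times m}$, where $a^t_{ij}=1$ iff $i\ne j$ and client $i$ imports the model of client $j$ in round $t$ (so $a^t_{ii}=0$). $\mathbf{a}^t_i$ is the $i$-th row of $\mathbf{A}^t$, and $\mathbf{e}_j$ is the $j$-th row of the identity matrix. The graph is computed by the server from the reported costs with the algorithm below. Collaboration gain. $G_i(\mathbf{a}_i)=g_i\big(\sum_{j\in[m]}a_{ij}N_j\big)$, where $g_i(x)=\sqrt{K_i/N_i}-\sqrt{K_i/(N_i+x)}$ for $x>-N_i$. Payment. The remittance from client $i$ to client $j$ is $$r^t_{ij}=a^t_{ij}\Big[G_i(\mathbf{a}^t_i)-G_i(\mathbf{a}^t_i-\mathbf{e}_j)-\lambda\tfrac{N_j}{N_i}d(\theta^t_i,\theta^t_j)\Big]$$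 (equal to $0$ when $a^t_{ij}=0$), and the overall payment of client $i$ is $p^t_i=\sum_{j\in[m]}r^t_{ij}-\sum_{j\in[m]}r^t_{ji}$. Utility. $U_i^t=G_i(\mathbf{a}^t_i)-\sum_{j\in[m]}a^t_{ji}c_i-p^t_i$, where $c_i$ is always the true cost of client $i$; the reported costs influence the utility only through the graph $\mathbf{A}^t$. Graph topology learning algorithm (used by the server to compute each row $\mathbf{a}_i$ of $\mathbf{A}^t$ at round $t$; here $c_j$ denotes the reported costs). For each $j\ne i$ calculate a threshold $N^{Th}_j$ by solving, over the real values at which both terms on the left are defined (i.e. $N^{Th}_j>N_j-N_i$), $$g_i(N^{Th}_j)-g_i(N^{Th}_j-N_j)=c_j+\lambda\tfrac{N_j}{N_i}d(\theta_i^t,\theta_j^t).$$ If there is no solution, set $N^{Th}_j=0$. If $K_i=0$, also set $N^{Th}_j=0$ (a client with $K_i=0$ imports no model). Then initialize $\mathbf{a}_i=\mathbf{0}$, $n=0$, and repeat as long as there is a $j\neq i$ with $a_{ij}=0$: let $k$ be an index with the largest $N^{Th}_k$ among all $k\ne i$ with $a_{ik}=0$ (ties broken by a fixed order on the clients); if $n+N_k<N^{Th}_k$, set $a_{ik}=1$ and $n\leftarrow n+N_k$; otherwise stop. Output $\mathbf{a}_i$. One-round comparison. The two utilities are compared within the same round $t$, with the same local models $\theta^t_1,\dots,\theta^t_m$ and the same $N_j,K_j$; only the reported cost of client $i$ differs.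
   Formalization: Added assumption: for every other client j with K_j > 0, either c_i > 0 or d(θ_j^t, θ_i^t) > 0. Otherwise the honest threshold equation has no solution, the threshold is set to 0, and over-reporting can strictly increase client i's utility. *)

theory Defs
  imports "HOL-Analysis.Analysis"
begin

text \<open>
  Clients are the elements of \<open>{1..m}\<close>. Throughout, \<open>N\<close> gives the data amounts, \<open>K\<close> the
  data-eagerness levels, \<open>th\<close> the models of one round, \<open>lam\<close> and \<open>d\<close> the weight and the measure
  of model difference. \<open>c\<close> is a vector of costs: the reported costs in \<open>threshold\<close> and
  \<open>sharing_graph\<close>. A row of a sharing graph is a real-valued function on clients, so that
  \<open>a - e\<^sub>j\<close> makes sense as a row.
\<close>

definition gain_fun :: "(nat \<Rightarrow> nat) \<Rightarrow> (nat \<Rightarrow> real) \<Rightarrow> nat \<Rightarrow> real \<Rightarrow> real" where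
  "gain_fun N K i x = sqrt (K i / real (N i)) - sqrt (K i / (real (N i) + x))"

definition collab_gain ::
  "nat \<Rightarrow> (nat \<Rightarrow> nat) \<Rightarrow> (nat \<Rightarrow> real) \<Rightarrow> nat \<Rightarrow> (nat \<Rightarrow> real) \<Rightarrow> real" where
  "collab_gain m N K i a = gain_fun N K i (\<Sum>j\<in>{1..m}. a j * real (N j))"

definition unit_row :: "nat \<Rightarrow> nat \<Rightarrow> real" where
  "unit_row j = (\<lambda>k. if k = j then 1 else 0)"

definition model_penalty ::
  "(nat \<Rightarrow> nat) \<Rightarrow> real \<Rightarrow> ('v \<Rightarrow> 'v \<Rightarrow> real) \<Rightarrow> (nat \<Rightarrow> 'v) \<Rightarrow> nat \<Rightarrow> nat \<Rightarrow> real" where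
  "model_penalty N lam d th i j = lam * (real (N j) / real (N i)) * d (th i) (th j)"

definition threshold_eq ::
  "(nat \<Rightarrow> nat) \<Rightarrow> (nat \<Rightarrow> real) \<Rightarrow> real \<Rightarrow> ('v \<Rightarrow> 'v \<Rightarrow> real) \<Rightarrow> (nat \<Rightarrow> 'v) \<Rightarrow> (nat \<Rightarrow> real)
     \<Rightarrow> nat \<Rightarrow> nat \<Rightarrow> real \<Rightarrow> bool" where
  "threshold_eq N K lam d th c i j x \<longleftrightarrow>
     x > real (N j) - real (N i) \<and>
     gain_fun N K i x - gain_fun N K i (x - real (N j)) = c j + model_penalty N lam d th i j"

text \<open>
  For \<open>K i > 0\<close> the left-hand side of the equation is strictly decreasing in \<open>x\<close>, so there is at
  most one solution and the choice operator is harmless. It also stays positive, so the equation has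
  no solution, and the threshold is \<open>0\<close>, when the right-hand side is \<open>0\<close>.
\<close>

definition threshold ::
  "(nat \<Rightarrow> nat) \<Rightarrow> (nat \<Rightarrow> real) \<Rightarrow> real \<Rightarrow> ('v \<Rightarrow> 'v \<Rightarrow> real) \<Rightarrow> (nat \<Rightarrow> 'v) \<Rightarrow> (nat \<Rightarrow> real)
     \<Rightarrow> nat \<Rightarrow> nat \<Rightarrow> real" where
  "threshold N K lam d th c i j =
     (if K i = 0 then 0
      else if \<exists>x. threshold_eq N K lam d th c i j x
      then SOME x. threshold_eq N K lam d th c i j x
      else 0)"

text \<open>
  Among the candidates in \<open>C\<close> with the largest threshold \<open>T\<close>, take the first one in the fixed
  order on the clients. That order is given by a ranking \<open>rk\<close>, assumed injective on the clients
  where it is used.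
\<close>

definition next_candidate :: "(nat \<Rightarrow> nat) \<Rightarrow> (nat \<Rightarrow> real) \<Rightarrow> nat set \<Rightarrow> nat" where
  "next_candidate rk T C = (ARG_MIN rk k. k \<in> C \<and> (\<forall>j\<in>C. T j \<le> T k))"

definition candidates :: "nat \<Rightarrow> nat \<Rightarrow> (nat \<Rightarrow> real) \<Rightarrow> nat set" where
  "candidates m i a = {j \<in> {1..m}. j \<noteq> i \<and> a j = 0}"

lemma next_candidate_mem:
  assumes "finite C" "C \<noteq> {}"
  shows "next_candidate rk T C \<in> C"
proof -
  have "Max (T ` C) \<in> T ` C"
    using assms by simp
  then obtain k where "k \<in> C" "T k = Max (T ` C)"
    by (metis imageE)
  then have "k \<in> C \<and> (\<forall>j\<in>C. T j \<le> T k)"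
    using assms by simp
  then show ?thesis
    unfolding next_candidate_def by (rule arg_min_natI[THEN conjunct1])
qed

function grow_row ::
  "nat \<Rightarrow> (nat \<Rightarrow> nat) \<Rightarrow> (nat \<Rightarrow> nat) \<Rightarrow> (nat \<Rightarrow> real) \<Rightarrow> nat \<Rightarrow> (nat \<Rightarrow> real) \<Rightarrow> nat
     \<Rightarrow> (nat \<Rightarrow> real)" where
  "grow_row m N rk T i a n =
     (if candidates m i a = {} then a
      else let k = next_candidate rk T (candidates m i a) in
        if real (n + N k) < T k then grow_row m N rk T i (a(k := 1)) (n + N k) else a)"
  by pat_completeness auto
termination
proof (relation "Wellfounded.measure (\<lambda>(m, N, rk, T, i, a, n). card (candidates m i a))")
  fix m and N rk :: "nat \<Rightarrow> nat" and T a :: "nat \<Rightarrow> real" and i n k :: nat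
  assume "candidates m i a \<noteq> {}" "k = next_candidate rk T (candidates m i a)"
  moreover have fin: "finite (candidates m i a)"
    by (simp add: candidates_def)
  ultimately have "k \<in> candidates m i a"
    by (simp add: next_candidate_mem)
  then have "candidates m i (a(k := 1)) \<subset> candidates m i a"
    by (auto simp: candidates_def)
  then show "((m, N, rk, T, i, a(k := 1), n + N k), (m, N, rk, T, i, a, n))
      \<in> Wellfounded.measure (\<lambda>(m, N, rk, T, i, a, n). card (candidates m i a))"
    by (simp add: psubset_card_mono fin)
qed simp

declare grow_row.simps [simp del]

definition sharing_graph ::
  "nat \<Rightarrow> (nat \<Rightarrow> nat) \<Rightarrow> (nat \<Rightarrow> real) \<Rightarrow> real \<Rightarrow> ('v \<Rightarrow> 'v \<Rightarrow> real) \<Rightarrow> (nat \<Rightarrow> nat)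
     \<Rightarrow> (nat \<Rightarrow> 'v) \<Rightarrow> (nat \<Rightarrow> real) \<Rightarrow> nat \<Rightarrow> nat \<Rightarrow> real" where
  "sharing_graph m N K lam d rk th c i =
     grow_row m N rk (threshold N K lam d th c i) i (\<lambda>_. 0) 0"

definition remittance ::
  "nat \<Rightarrow> (nat \<Rightarrow> nat) \<Rightarrow> (nat \<Rightarrow> real) \<Rightarrow> real \<Rightarrow> ('v \<Rightarrow> 'v \<Rightarrow> real) \<Rightarrow> (nat \<Rightarrow> 'v)
     \<Rightarrow> (nat \<Rightarrow> nat \<Rightarrow> real) \<Rightarrow> nat \<Rightarrow> nat \<Rightarrow> real" where
  "remittance m N K lam d th A i j =
     A i j * (collab_gain m N K i (A i) - collab_gain m N K i (\<lambda>k. A i k - unit_row j k)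
              - model_penalty N lam d th i j)"

definition payment ::
  "nat \<Rightarrow> (nat \<Rightarrow> nat) \<Rightarrow> (nat \<Rightarrow> real) \<Rightarrow> real \<Rightarrow> ('v \<Rightarrow> 'v \<Rightarrow> real) \<Rightarrow> (nat \<Rightarrow> 'v)
     \<Rightarrow> (nat \<Rightarrow> nat \<Rightarrow> real) \<Rightarrow> nat \<Rightarrow> real" where
  "payment m N K lam d th A i =
     (\<Sum>j\<in>{1..m}. remittance m N K lam d th A i j) - (\<Sum>j\<in>{1..m}. remittance m N K lam d th A j i)"

definition utility ::
  "nat \<Rightarrow> (nat \<Rightarrow> nat) \<Rightarrow> (nat \<Rightarrow> real) \<Rightarrow> real \<Rightarrow> ('v \<Rightarrow> 'v \<Rightarrow> real) \<Rightarrow> (nat \<Rightarrow> 'v)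
     \<Rightarrow> (nat \<Rightarrow> real) \<Rightarrow> (nat \<Rightarrow> nat \<Rightarrow> real) \<Rightarrow> nat \<Rightarrow> real" where
  "utility m N K lam d th c A i =
     collab_gain m N K i (A i) - (\<Sum>j\<in>{1..m}. A j i * c i) - payment m N K lam d th A i"

end

theory Submission
  imports Defs
begin

text \<open>
  Let client \<open>j\<close> scan the other clients by decreasing threshold, ties broken by \<open>rk\<close>. Along this
  scan the accumulated data amount grows while the thresholds fall, so the greedy algorithm imports
  exactly those \<open>k\<close> for which the total data amount of the clients up to and including \<open>k\<close> is below
  the threshold of \<open>k\<close>.

  Overreporting by \<open>i\<close> leaves row \<open>i\<close> unchanged and only lowers the threshold of \<open>i\<close> in the other
  rows. If \<open>j\<close> still imports \<open>i\<close>, every client that overtakes \<open>i\<close> in the scan is imported in both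
  cases, so row \<open>j\<close> does not change at all. If \<open>j\<close> does not import \<open>i\<close> any more, then \<open>i\<close> loses the
  remittance from \<open>j\<close> minus \<open>c i\<close>. This is nonnegative: the final data amount imported by \<open>j\<close> is
  below the threshold of \<open>i\<close>, where the decreasing marginal gain equals \<open>c i\<close> plus the model
  penalty.
\<close>

section \<open>The greedy row in closed form\<close>

definition scan_le :: "('a \<Rightarrow> nat) \<Rightarrow> ('a \<Rightarrow> real) \<Rightarrow> 'a \<Rightarrow> 'a \<Rightarrow> bool" where
  "scan_le rk T l k \<longleftrightarrow> T k < T l \<or> T l = T k \<and> rk l \<le> rk k"

text \<open>The prefix sum includes \<open>k\<close> itself, like the test
  \<open>n + N k < T k\<close>. Each client is judged on its own; stopping at the first failure is
  recovered from downward closure.\<close>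

definition imported :: "'a set \<Rightarrow> ('a \<Rightarrow> nat) \<Rightarrow> ('a \<Rightarrow> nat) \<Rightarrow> ('a \<Rightarrow> real) \<Rightarrow> 'a set" where
  "imported V N rk T = {k \<in> V. real (sum N {l \<in> V. scan_le rk T l k}) < T k}"

lemma scan_le_refl: "scan_le rk T k k"
  by (simp add: scan_le_def)

lemma scan_le_trans: "scan_le rk T j l \<Longrightarrow> scan_le rk T l k \<Longrightarrow> scan_le rk T j k"
  by (auto simp: scan_le_def)

lemma scan_le_total: "scan_le rk T l k \<or> scan_le rk T k l"
  by (auto simp: scan_le_def)

lemma scan_le_antisym:
  "inj_on rk V \<Longrightarrow> l \<in> V \<Longrightarrow> k \<in> V \<Longrightarrow> scan_le rk T l k \<Longrightarrow> scan_le rk T k l \<Longrightarrow> l = k"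
  by (auto simp: scan_le_def inj_on_def)

text \<open>Moving earlier in the scan shrinks the prefix sum and never lowers the threshold, so the
  test only gets easier.\<close>

lemma imported_downward_closed:
  assumes "finite V" "k \<in> imported V N rk T" "l \<in> V" "scan_le rk T l k"
  shows "l \<in> imported V N rk T"
proof -
  have "real (sum N {j \<in> V. scan_le rk T j l}) \<le> real (sum N {j \<in> V. scan_le rk T j k})"
    using assms unfolding of_nat_le_iff by (intro sum_mono2) (auto intro: scan_le_trans)
  moreover have "T k \<le> T l"
    using assms(4) by (auto simp: scan_le_def)
  ultimately show ?thesis
    using assms by (simp add: imported_def del: of_nat_sum)
qed

lemma imported_cong:
  assumes "\<And>k. k \<in> V \<Longrightarrow> T k = T' k"
  shows "imported V N rk T = imported V N rk T'"
proof -
  have "{l \<in> V. scan_le rk T l k} = {l \<in> V. scan_le rk T' l k}" if "k \<in> V" for k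
    using assms that by (auto simp: scan_le_def)
  then show ?thesis
    using assms by (auto simp: imported_def)
qed

lemma sum_imported_less:
  assumes "finite V" "i \<in> imported V N rk T"
  shows "real (sum N (imported V N rk T)) < T i"
proof -
  let ?S = "imported V N rk T"
  have fin: "finite ?S"
    using assms(1) by (simp add: imported_def)
  \<comment> \<open>\<open>M\<close> collects the ties for the least imported threshold; its member
    of largest rank comes last in the scan, so its prefix covers everything imported.\<close>
  define M where "M = {k \<in> ?S. \<forall>j\<in>?S. T k \<le> T j}"
  have M: "finite M" "M \<noteq> {}"
  proof -
    have "Min (T ` ?S) \<in> T ` ?S"
      using fin assms(2) by (intro Min_in) auto
    then obtain k where "k \<in> ?S" "T k = Min (T ` ?S)"
      by (metis imageE)
    then have "k \<in> M"
      using fin by (simp add: M_def)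
    then show "M \<noteq> {}" by blast
    show "finite M" using fin by (simp add: M_def)
  qed
  then have "Max (rk ` M) \<in> rk ` M"
    by simp
  then obtain k where k: "k \<in> M" "rk k = Max (rk ` M)"
    by (metis imageE)
  have last: "scan_le rk T j k" if "j \<in> ?S" for j
  proof (cases "T k < T j")
    case False
    then have "T j = T k"
      using k(1) that by (force simp: M_def)
    then have "j \<in> M"
      using k(1) that by (auto simp: M_def)
    then show ?thesis
      using k M \<open>T j = T k\<close> by (simp add: scan_le_def)
  qed (simp add: scan_le_def)
  have "?S \<subseteq> {j \<in> V. scan_le rk T j k}"
    using last by (auto simp: imported_def)
  then have "sum N ?S \<le> sum N {j \<in> V. scan_le rk T j k}"
    using assms(1) by (intro sum_mono2) auto
  moreover have "real (sum N {j \<in> V. scan_le rk T j k}) < T k"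
    using k(1) by (simp add: M_def imported_def)
  moreover have "T k \<le> T i"
    using k(1) assms(2) by (simp add: M_def)
  ultimately show ?thesis by linarith
qed

lemma imported_lower_threshold:
  assumes fin: "finite V"
    and i: "i \<in> imported V N rk T'"
    and lower: "T' i \<le> T i"
    and others: "\<And>k. k \<in> V \<Longrightarrow> k \<noteq> i \<Longrightarrow> T' k = T k"
  shows "imported V N rk T' = imported V N rk T"
proof -
  have iV: "i \<in> V"
    using i by (simp add: imported_def)
  let ?P = "\<lambda>T k. {l \<in> V. scan_le rk T l k}"
  have "k \<in> imported V N rk T' \<longleftrightarrow> k \<in> imported V N rk T" if k: "k \<in> V" for k
  proof (cases "scan_le rk T' k i")
    case True
    then have "k \<in> imported V N rk T'"
      using imported_downward_closed[OF fin i k] by simp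
    moreover have "k \<in> imported V N rk T"
    proof -
      \<comment> \<open>\<open>k\<close> may fall behind \<open>i\<close> under \<open>T\<close>,
        but its prefix stays within that of \<open>i\<close> under \<open>T'\<close>, whose sum is
        below \<open>T' i\<close> and hence below \<open>T k\<close>.\<close>
      have "T' i \<le> T k"
        using True lower others[OF k] by (cases "k = i") (auto simp: scan_le_def)
      moreover have "?P T k \<subseteq> ?P T' i"
      proof
        fix l
        assume l: "l \<in> ?P T k"
        show "l \<in> ?P T' i"
        proof (cases "l = i")
          case True
          then show ?thesis using iV by (simp add: scan_le_refl)
        next
          case False
          show ?thesis
            using l True lower others[OF k] others[of l] False
            by (cases "k = i") (auto simp: scan_le_def)
        qed
      qed
      then have "real (sum N (?P T k)) \<le> real (sum N (?P T' i))"
        using fin unfolding of_nat_le_iff by (intro sum_mono2) auto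
      moreover have "real (sum N (?P T' i)) < T' i"
        using i by (simp add: imported_def)
      ultimately show ?thesis
        using k by (simp add: imported_def del: of_nat_sum)
    qed
    ultimately show ?thesis by simp
  next
    case False
    then have ki: "k \<noteq> i"
      by (auto simp: scan_le_refl)
    \<comment> \<open>Here \<open>i\<close> precedes \<open>k\<close> under \<open>T'\<close>, hence
      also under \<open>T\<close>, where its threshold is at least as high; the other comparisons do
      not involve \<open>i\<close>.\<close>
    have "?P T' k = ?P T k"
    proof (intro Collect_cong conj_cong refl)
      fix l
      assume "l \<in> V"
      then show "scan_le rk T' l k = scan_le rk T l k"
        using False lower others[OF k ki] others[of l]
        by (cases "l = i") (auto simp: scan_le_def)
    qed
    then show ?thesis
      using others[OF k ki] by (simp add: imported_def)
  qed
  then show ?thesis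
    by (auto simp: imported_def)
qed

lemma next_candidate_scan_le:
  assumes "finite C" "C \<noteq> {}" "l \<in> C"
  shows "scan_le rk T (next_candidate rk T C) l"
proof -
  let ?Q = "\<lambda>k. k \<in> C \<and> (\<forall>j\<in>C. T j \<le> T k)"
  \<comment> \<open>A maximiser is exhibited first: \<open>ARG_MIN\<close> is meaningful only if its
    predicate is satisfiable.\<close>
  have "Max (T ` C) \<in> T ` C"
    using assms by simp
  then obtain k0 where "k0 \<in> C" "T k0 = Max (T ` C)"
    by (metis imageE)
  then have "?Q k0"
    using assms by simp
  then have max: "?Q (next_candidate rk T C)"
    unfolding next_candidate_def by (rule arg_min_natI)
  have "rk (next_candidate rk T C) \<le> rk l" if "T l = T (next_candidate rk T C)"
    unfolding next_candidate_def
    by (rule arg_min_nat_le) (use that max assms in auto)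
  then show ?thesis
    using max assms(3) by (force simp: scan_le_def)
qed

text \<open>Induction on the number of clients outside \<open>B\<close>. The invariant is that
  \<open>B\<close> is an initial segment of the scan made of imported clients; the algorithm starts
  from \<open>B = {}\<close>.\<close>

lemma grow_row_eq_imported:
  fixes m i :: nat and N rk :: "nat \<Rightarrow> nat" and T :: "nat \<Rightarrow> real"
  defines "V \<equiv> {1..m} - {i}"
  assumes inj: "inj_on rk {1..m}"
    and "a = indicator B" "n = sum N B" "B \<subseteq> imported V N rk T"
    and "\<And>k l. k \<in> B \<Longrightarrow> l \<in> V \<Longrightarrow> scan_le rk T l k \<Longrightarrow> l \<in> B"
  shows "grow_row m N rk T i a n = indicator (imported V N rk T)"
  using assms(3-)
proof (induction "card (V - B)" arbitrary: a n B rule: less_induct)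
  case less
  let ?S = "imported V N rk T"
  have finV: "finite V" and SV: "?S \<subseteq> V"
    by (auto simp: V_def imported_def)
  have BV: "B \<subseteq> V"
    using less.prems(3) SV by blast
  then have finB: "finite B"
    using finV by (rule finite_subset)
  have C: "candidates m i a = V - B"
    using less.prems(1) by (auto simp: candidates_def V_def indicator_def)
  show ?case
  proof (cases "V - B = {}")
    case True
    then have "B = ?S"
      using less.prems(3) SV by blast
    then show ?thesis
      using True C less.prems(1) by (subst grow_row.simps) simp
  next
    case False
    define k where "k = next_candidate rk T (V - B)"
    have k: "k \<in> V - B"
      unfolding k_def using finV False by (intro next_candidate_mem) auto
    have first: "scan_le rk T k l" if "l \<in> V - B" for l
      unfolding k_def using finV False that by (intro next_candidate_scan_le) auto
    have injV: "inj_on rk V"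
      using inj by (rule inj_on_subset) (auto simp: V_def)
    \<comment> \<open>Since \<open>B\<close> is an initial segment and \<open>k\<close> is first
      outside it, the running test of the algorithm is exactly the test defining
      \<open>imported\<close>.\<close>
    have prefix: "{l \<in> V. scan_le rk T l k} = insert k B"
    proof
      show "{l \<in> V. scan_le rk T l k} \<subseteq> insert k B"
        using first k scan_le_antisym[OF injV] by blast
      show "insert k B \<subseteq> {l \<in> V. scan_le rk T l k}"
        using k BV less.prems(4) scan_le_total[of rk T k] scan_le_refl[of rk T k] by blast
    qed
    have test: "real (n + N k) < T k \<longleftrightarrow> k \<in> ?S"
      using k finB less.prems(2) prefix by (simp add: imported_def add.commute)
    show ?thesis
    proof (cases "k \<in> ?S")
      case True
      have "grow_row m N rk T i (a(k := 1)) (n + N k) = indicator ?S"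
      proof (rule less.hyps)
        show "card (V - insert k B) < card (V - B)"
          using k finV by (intro psubset_card_mono) auto
        show "a(k := 1) = indicator (insert k B)"
          using less.prems(1) by (auto simp: indicator_def)
        show "n + N k = sum N (insert k B)"
          using less.prems(2) k finB by simp
        show "insert k B \<subseteq> ?S"
          using True less.prems(3) by simp
        show "l \<in> insert k B" if "j \<in> insert k B" "l \<in> V" "scan_le rk T l j" for j l
          using that less.prems(4) prefix by blast
      qed
      then show ?thesis
        using True test C False by (subst grow_row.simps) (simp add: k_def Let_def)
    next
      case False
      \<comment> \<open>An imported client outside \<open>B\<close> would be scanned no earlier than
        \<open>k\<close>, and downward closure would make \<open>k\<close> imported too.\<close>
      then have "?S \<subseteq> B"
        using imported_downward_closed[OF finV] k first SV by blast
      then have "B = ?S"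
        using less.prems(3) by blast
      then show ?thesis
        using False test C \<open>V - B \<noteq> {}\<close> less.prems(1)
        by (subst grow_row.simps) (simp add: k_def Let_def)
    qed
  qed
qed

lemma sharing_graph_eq_imported:
  assumes "inj_on rk {1..m}"
  shows "sharing_graph m N K lam d rk th c i
    = indicator (imported ({1..m} - {i}) N rk (threshold N K lam d th c i))"
  unfolding sharing_graph_def
  by (rule grow_row_eq_imported[OF assms, where B = "{}"]) (auto simp: indicator_def)

section \<open>The marginal gain\<close>

lemma inverse_sqrt_diff_strict_antimono:
  fixes b x y :: real
  assumes "0 < b" "0 < x" "x < y"
  shows "1 / sqrt y - 1 / sqrt (y + b) < 1 / sqrt x - 1 / sqrt (x + b)"
proof -
  \<comment> \<open>Rationalising leaves a constant over a product of increasing factors.\<close>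
  have eq: "1 / sqrt z - 1 / sqrt (z + b)
      = b / (sqrt z * sqrt (z + b) * (sqrt z + sqrt (z + b)))" if "0 < z" for z
  proof -
    define p where "p = sqrt z"
    define q where "q = sqrt (z + b)"
    have "0 < p" "0 < q" "b = q\<^sup>2 - p\<^sup>2"
      using that assms(1) by (auto simp: p_def q_def)
    then have "1 / p - 1 / q = b / (p * q * (p + q))"
      by (simp add: divide_simps power2_eq_square) (simp add: algebra_simps)
    then show ?thesis
      by (simp add: p_def q_def)
  qed
  have pos: "0 < sqrt x" "0 < sqrt (x + b)"
    using assms by auto
  have lt: "sqrt x < sqrt y" "sqrt (x + b) < sqrt (y + b)"
    using assms by auto
  have "sqrt x * sqrt (x + b) * (sqrt x + sqrt (x + b))
      < sqrt y * sqrt (y + b) * (sqrt y + sqrt (y + b))"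
    using pos lt by (intro mult_strict_mono add_strict_mono mult_pos_pos) auto
  then have "b / (sqrt y * sqrt (y + b) * (sqrt y + sqrt (y + b)))
      < b / (sqrt x * sqrt (x + b) * (sqrt x + sqrt (x + b)))"
    using pos lt assms(1) by (intro divide_strict_left_mono mult_pos_pos add_pos_pos) linarith+
  then show ?thesis
    using eq assms by simp
qed

lemma inverse_sqrt_diff_surj:
  fixes b s :: real
  assumes "0 < b" "0 < s"
  obtains y where "0 < y" "1 / sqrt y - 1 / sqrt (y + b) = s"
proof -
  define f where "f = (\<lambda>y::real. 1 / sqrt y - 1 / sqrt (y + b))"
  \<comment> \<open>Endpoints for the intermediate value theorem: \<open>1 / sqrt p = u\<close>, and
    subtracting at most \<open>1 / sqrt b\<close> still leaves \<open>s\<close>; at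
    \<open>(1 / s)\<^sup>2\<close> the first term alone is \<open>s\<close>.\<close>
  define u where "u = s + 1 / sqrt b"
  have u: "0 < u" "s \<le> u"
    using assms by (auto simp: u_def intro: add_pos_pos)
  define p where "p = (1 / u)\<^sup>2"
  have p_pos: "0 < p"
    using u by (simp add: p_def)
  have "f ((1 / s)\<^sup>2) \<le> s"
    using assms by (simp add: f_def)
  moreover have "s \<le> f p"
  proof -
    have "1 / sqrt ((1 / u)\<^sup>2 + b) \<le> 1 / sqrt b"
      using assms by (intro divide_left_mono mult_pos_pos) (auto intro: add_nonneg_pos)
    moreover have "1 / sqrt ((1 / u)\<^sup>2) = u"
      using u by simp
    ultimately show ?thesis
      by (simp add: f_def u_def p_def)
  qed
  moreover have "p \<le> (1 / s)\<^sup>2"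
    unfolding p_def using u assms by (intro power_mono divide_left_mono) auto
  moreover have "continuous_on {p..(1 / s)\<^sup>2} f"
    unfolding f_def using p_pos assms(1) by (intro continuous_intros) auto
  ultimately obtain y where "p \<le> y" "f y = s"
    using IVT2'[of f "(1 / s)\<^sup>2" s p] by auto
  then show thesis
    using that[of y] p_pos by (simp add: f_def)
qed

text \<open>In the variable \<open>N j + x - N i\<close> the domain of the threshold equation
  becomes the positive half-line, where the facts on inverse square roots apply.\<close>

lemma gain_fun_diff:
  "gain_fun N K j x - gain_fun N K j (x - real (N i))
    = sqrt (K j) * (1 / sqrt (real (N j) + x - real (N i))
        - 1 / sqrt (real (N j) + x - real (N i) + real (N i)))"
  by (simp add: gain_fun_def real_sqrt_divide algebra_simps)

lemma gain_fun_diff_strict_antimono: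
  assumes "K j > 0" "N i > 0" "real (N i) - real (N j) < x" "x < y"
  shows "gain_fun N K j y - gain_fun N K j (y - real (N i))
    < gain_fun N K j x - gain_fun N K j (x - real (N i))"
  unfolding gain_fun_diff using assms
  by (intro mult_strict_left_mono inverse_sqrt_diff_strict_antimono) auto

lemma threshold_cong:
  assumes "c k = c' k"
  shows "threshold N K lam d th c j k = threshold N K lam d th c' j k"
proof -
  have "threshold_eq N K lam d th c j k = threshold_eq N K lam d th c' j k"
    using assms by (simp add: threshold_eq_def fun_eq_iff)
  then show ?thesis
    by (auto simp: threshold_def)
qed

text \<open>The marginal gain takes every positive value, so a positive right-hand side rules out
  the default branch of \<open>threshold\<close>.\<close>

lemma threshold_eq_threshold:
  assumes "K j > 0" "N i > 0" "c i + model_penalty N lam d th j i > 0"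
  shows "threshold_eq N K lam d th c j i (threshold N K lam d th c j i)"
proof -
  let ?r = "c i + model_penalty N lam d th j i"
  have "0 < ?r / sqrt (K j)" "0 < real (N i)"
    using assms by auto
  then obtain y where y: "0 < y" "1 / sqrt y - 1 / sqrt (y + real (N i)) = ?r / sqrt (K j)"
    using inverse_sqrt_diff_surj by metis
  have "threshold_eq N K lam d th c j i (y + real (N i) - real (N j))"
    using y assms(1) unfolding threshold_eq_def gain_fun_diff by simp
  then have "\<exists>x. threshold_eq N K lam d th c j i x" ..
  then show ?thesis
    using assms(1) by (auto simp: threshold_def intro: someI_ex)
qed

section \<open>The contribution of one importer\<close>

lemma collab_gain_indicator:
  assumes "S \<subseteq> {1..m}"
  shows "collab_gain m N K j (indicator S) = gain_fun N K j (real (sum N S))"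
proof -
  have "(\<Sum>k\<in>{1..m}. indicator S k * real (N k)) = (\<Sum>k\<in>S. real (N k))"
    using assms by (intro sum.mono_neutral_cong_right) auto
  then show ?thesis
    by (simp add: collab_gain_def)
qed

lemma collab_gain_indicator_minus_unit_row:
  assumes "S \<subseteq> {1..m}" "i \<in> S"
  shows "collab_gain m N K j (\<lambda>k. indicator S k - unit_row i k)
    = gain_fun N K j (real (sum N S) - real (N i))"
proof -
  have "(\<lambda>k. indicator S k - unit_row i k) = indicator (S - {i})"
    using assms(2) by (auto simp: indicator_def unit_row_def)
  moreover have "finite S"
    using assms(1) by (rule finite_subset) simp
  then have "real (sum N S) = real (N i) + real (sum N (S - {i}))"
    using assms(2) by (simp add: sum.remove)
  ultimately show ?thesis
    using assms(1) collab_gain_indicator[of "S - {i}" m N K j] by auto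
qed

text \<open>Apart from its own row, the utility of \<open>i\<close> is a sum of such terms over
  importers \<open>j\<close>. The true cost \<open>c i\<close> stays on both sides; only the graph
  changes.\<close>

lemma importer_contribution_mono:
  fixes m :: nat and N :: "nat \<Rightarrow> nat" and c K :: "nat \<Rightarrow> real"
  assumes inj: "inj_on rk {1..m}"
    and i: "i \<in> {1..m}" and "j \<noteq> i" and Ni: "N i > 0" and Nj: "N j > 0" and Kj: "K j \<ge> 0"
    and cost: "K j > 0 \<Longrightarrow> c i + model_penalty N lam d th j i > 0"
    and overreport: "chat > c i"
  defines "A \<equiv> sharing_graph m N K lam d rk th c"
    and "A' \<equiv> sharing_graph m N K lam d rk th (c(i := chat))"
  shows "remittance m N K lam d th A' j i - A' j i * c i
    \<le> remittance m N K lam d th A j i - A j i * c i"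
proof -
  define V where "V = {1..m} - {j}"
  define T where "T = threshold N K lam d th c j"
  define T' where "T' = threshold N K lam d th (c(i := chat)) j"
  define S where "S = imported V N rk T"
  define S' where "S' = imported V N rk T'"
  have A: "A j = indicator S" and A': "A' j = indicator S'"
    unfolding A_def A'_def S_def S'_def V_def T_def T'_def
    using sharing_graph_eq_imported[OF inj] by auto
  have finV: "finite V" and SV: "S \<subseteq> {1..m}"
    by (auto simp: V_def S_def imported_def)
  show ?thesis
  proof (cases "K j > 0")
    case False
    \<comment> \<open>With \<open>K j = 0\<close> all thresholds are \<open>0\<close>, whatever is
      reported.\<close>
    then have "T = T'"
      using Kj by (simp add: T_def T'_def threshold_def fun_eq_iff)
    then have "A' j = A j"
      by (simp add: A A' S_def S'_def)
    then show ?thesis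
      by (simp add: remittance_def)
  next
    case True
    have T: "threshold_eq N K lam d th c j i (T i)"
      unfolding T_def using threshold_eq_threshold True Ni cost by blast
    have T': "threshold_eq N K lam d th (c(i := chat)) j i (T' i)"
      unfolding T'_def
      by (rule threshold_eq_threshold) (use True Ni cost overreport in auto)
    show ?thesis
    proof (cases "i \<in> S'")
      case i': True
      \<comment> \<open>If \<open>T' i\<close> exceeded \<open>T i\<close>, the marginal gain there
        would be smaller, yet it equals the larger right-hand side.\<close>
      have "T' i \<le> T i"
        using gain_fun_diff_strict_antimono[of K j N i "T i" "T' i"] T T' True Ni overreport
        by (force simp: threshold_eq_def)
      moreover have "T' k = T k" if "k \<noteq> i" for k
        using that unfolding T_def T'_def by (intro threshold_cong) simp
      ultimately have "S' = S"
        unfolding S_def S'_def using finV i'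
        by (intro imported_lower_threshold) (auto simp: S'_def)
      then have "A' j = A j"
        by (simp add: A A')
      then show ?thesis
        by (simp add: remittance_def)
    next
      case False
      then have lost: "A' j i = 0"
        by (simp add: A')
      have "0 \<le> remittance m N K lam d th A j i - A j i * c i"
      proof (cases "i \<in> S")
        case iS: True
        let ?n = "real (sum N S)"
        have "?n < T i"
          unfolding S_def using finV iS by (intro sum_imported_less) (auto simp: S_def)
        \<comment> \<open>\<open>?n\<close> must lie in the domain on which the marginal gain
          strictly decreases; it does because the sum contains \<open>N i\<close>.\<close>
        moreover have "real (N i) - real (N j) < ?n"
        proof -
          have "N i \<le> sum N S"
            using iS finite_subset[OF SV] by (intro member_le_sum) auto
          then show ?thesis using Nj by linarith
        qed
        ultimately have "gain_fun N K j (T i) - gain_fun N K j (T i - real (N i))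
            < gain_fun N K j ?n - gain_fun N K j (?n - real (N i))"
          using True Ni by (intro gain_fun_diff_strict_antimono) auto
        then show ?thesis
          using T iS collab_gain_indicator[OF SV] collab_gain_indicator_minus_unit_row[OF SV iS]
          by (simp add: remittance_def A threshold_eq_def)
      qed (simp add: remittance_def A)
      then show ?thesis
        by (simp add: remittance_def lost)
    qed
  qed
qed

text \<open>\<open>nondegenerate\<close> keeps the honest right-hand side positive for every
  importer with \<open>K j > 0\<close>. Were it \<open>0\<close>, the honest threshold would default
  to \<open>0\<close> and block the import, while overreporting could enable it.\<close>

theorem theorem2:
  fixes m :: nat and N :: "nat \<Rightarrow> nat" and c K :: "nat \<Rightarrow> real"
    and lam :: real and d :: "real ^ 'n \<Rightarrow> real ^ 'n \<Rightarrow> real"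
    and rk :: "nat \<Rightarrow> nat" and theta :: "nat \<Rightarrow> nat \<Rightarrow> real ^ 'n"
    and i t :: nat and chat :: real
  assumes N_pos: "\<And>j. j \<in> {1..m} \<Longrightarrow> N j > 0"
    and c_nonneg: "\<And>j. j \<in> {1..m} \<Longrightarrow> c j \<ge> 0"
    and K_nonneg: "\<And>j. j \<in> {1..m} \<Longrightarrow> K j \<ge> 0"
    and lam_pos: "lam > 0"
    and d_nonneg: "\<And>x y. d x y \<ge> 0"
    and d_differentiable: "(\<lambda>(x, y). d x y) differentiable_on UNIV"
    and rk_inj: "inj_on rk {1..m}"
    and i_client: "i \<in> {1..m}"
    and overreport: "chat > c i"
    and nondegenerate: "\<And>j. j \<in> {1..m} \<Longrightarrow> j \<noteq> i \<Longrightarrow> K j > 0 \<Longrightarrow>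
      c i > 0 \<or> d (theta t j) (theta t i) > 0"
  shows "utility m N K lam d (theta t) c
           (sharing_graph m N K lam d rk (theta t) (c(i := chat))) i
       \<le> utility m N K lam d (theta t) c
           (sharing_graph m N K lam d rk (theta t) c) i"
proof -
  define A where "A = sharing_graph m N K lam d rk (theta t) c"
  define A' where "A' = sharing_graph m N K lam d rk (theta t) (c(i := chat))"
  let ?r = "remittance m N K lam d (theta t)"
  \<comment> \<open>Row \<open>i\<close> is built from the costs of the others, and
    \<open>chat\<close> enters only at \<open>i\<close>.\<close>
  have row: "A' i = A i"
    unfolding A_def A'_def sharing_graph_eq_imported[OF rk_inj]
    by (intro arg_cong[where f = indicator] imported_cong threshold_cong) simp
  have "?r A' j i - A' j i * c i \<le> ?r A j i - A j i * c i" if j: "j \<in> {1..m}" for j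
  proof (cases "j = i")
    case True
    then show ?thesis
      by (simp add: remittance_def row)
  next
    case False
    have "c i + model_penalty N lam d (theta t) j i > 0" if "K j > 0"
      using nondegenerate[OF j False that] c_nonneg[OF i_client] d_nonneg[of "theta t j" "theta t i"]
        lam_pos N_pos[OF j] N_pos[OF i_client]
      by (auto simp: model_penalty_def intro: add_pos_nonneg add_nonneg_pos)
    then show ?thesis
      unfolding A_def A'_def using rk_inj i_client False N_pos j K_nonneg overreport
      by (intro importer_contribution_mono) auto
  qed
  then have "(\<Sum>j\<in>{1..m}. ?r A' j i - A' j i * c i) \<le> (\<Sum>j\<in>{1..m}. ?r A j i - A j i * c i)"
    by (rule sum_mono)
  moreover have "?r A' i j = ?r A i j" for j
    by (simp add: remittance_def row)
  ultimately show ?thesis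
    unfolding A_def[symmetric] A'_def[symmetric]
    by (simp add: utility_def payment_def row sum_subtractf)
qed

end
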